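(* Let $v_0,\ldots,v_6$ be a basis of $\mathbb{C}^7$ and $\mathbb{P}^6=\mathbb{P}(\mathbb{C}^7)$. The collection of planes $\Lambda_1,\ldots,\Lambda_7\subset\mathbb{P}^6$ defined by $$\Lambda_1=\mathbb{P}\langle v_0,v_1,v_2\rangle,\quad \Lambda_2=\mathbb{P}\langle v_2,v_3,v_4\rangle,\quad \Lambda_3=\mathbb{P}\langle v_0,v_4,v_5\rangle,\quad \Lambda_4=\mathbb{P}\langle v_1,v_3,v_5\rangle,$$ $$\Lambda_5=\mathbb{P}\langle v_0,v_3,v_6\rangle,\quad \Lambda_6=\mathbb{P}\langle v_1,v_4,v_6\rangle,\quad \Lambda_7=\mathbb{P}\langle v_2,v_5,v_6\rangle$$ is a complete family of pairwise incident planes.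
   Context: We work over $\mathbb{C}$. A family $T$ of planes in $\mathbb{P}^N$ is a family of pairwise incident planes if any two planes of $T$ have non-empty intersection; it is complete if there is no plane in $\mathbb{P}^N$ outside $T$ which meets all planes in $T$. *)

theory Defs
  imports "HOL-Analysis.Analysis"
begin

text \<open>
  Projective space over the complex numbers is taken in the sense of lines: its points are the
  one-dimensional linear subspaces of \<open>\<complex>\<^sup>n\<close>, where \<open>n\<close> is the cardinality of the index type
  (so projective dimension \<open>N\<close> corresponds to \<open>n = N + 1\<close>).
  The prefix \<open>vec\<close> refers to linear algebra over the scalar field \<open>complex\<close>; the unprefixed
  \<open>subspace\<close>, \<open>span\<close>, \<open>dim\<close> are the real notions.
\<close>

definition proj :: "(complex ^ 'n) set \<Rightarrow> (complex ^ 'n) set set" where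
  "proj W = {L. vec.subspace L \<and> vec.dim L = 1 \<and> L \<subseteq> W}"

text \<open>Planes are identified with their sets of points.\<close>

definition planes :: "(complex ^ 'n) set set set" where
  "planes = {proj W |W. vec.subspace W \<and> vec.dim W = 3}"

definition pairwise_incident_planes :: "(complex ^ 'n) set set set \<Rightarrow> bool" where
  "pairwise_incident_planes T \<longleftrightarrow> T \<subseteq> planes \<and> (\<forall>P\<in>T. \<forall>Q\<in>T. P \<inter> Q \<noteq> {})"

definition complete_pairwise_incident_planes :: "(complex ^ 'n) set set set \<Rightarrow> bool" where
  "complete_pairwise_incident_planes T \<longleftrightarrow>
     pairwise_incident_planes T \<and> \<not> (\<exists>P\<in>planes. P \<notin> T \<and> (\<forall>Q\<in>T. P \<inter> Q \<noteq> {}))"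

end

theory Submission
  imports Defs
begin

text \<open>
  The seven triples of indices are the lines of the Fano plane. Any two of them share a point, and
  so the seven planes are pairwise incident.

  For completeness, let \<open>W\<close> be a three-dimensional subspace with \<open>P = \<P>(W)\<close> meeting all seven
  planes. By Steinitz exchange, four of the basis vectors, say those with indices in \<open>J\<close>,
  span a complement of \<open>W\<close>. Since \<open>W\<close> meets the span of every line, \<open>J\<close> contains no
  line; but a set of four points of the Fano plane that contains no line is the complement of a line
  \<open>l\<close>. This holds for \<^emph>\<open>every\<close> such \<open>J\<close>, and that is what makes the family
  rigid. If \<open>v i \<notin> W\<close> for some \<open>i \<in> l\<close>, then \<open>v i\<close> can replace some \<open>v m\<close> with
  \<open>m \<in> J\<close>, and the new four vectors again span a complement of \<open>W\<close>
  (lemma \<open>exchange_in_complement\<close>). Hence \<open>l\<close> with \<open>i\<close> replaced by \<open>m\<close> is a line as well. It shares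
  two points with \<open>l\<close>, which is impossible for two lines. So \<open>v i \<in> W\<close> for all
  \<open>i \<in> l\<close>, and \<open>W\<close> is the span of these three vectors.
\<close>

section \<open>The Fano plane\<close>

definition fano_lines :: "nat set set" where
  "fano_lines = {{0,1,2}, {2,3,4}, {0,4,5}, {1,3,5}, {0,3,6}, {1,4,6}, {2,5,6}}"

lemma fano_line_subset: "l \<in> fano_lines \<Longrightarrow> l \<subseteq> {0..6}"
  by (auto simp: fano_lines_def)

lemma card_fano_line: "l \<in> fano_lines \<Longrightarrow> card l = 3"
  by (auto simp: fano_lines_def)

lemma card_Int_fano_lines:
  assumes "l \<in> fano_lines" "l' \<in> fano_lines" "l \<noteq> l'"
  shows "card (l \<inter> l') = 1"
proof -
  have "\<forall>l\<in>fano_lines. \<forall>l'\<in>fano_lines. l \<noteq> l' \<longrightarrow> card (l \<inter> l') = 1"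
    unfolding fano_lines_def by code_simp
  with assms show ?thesis
    by blast
qed

lemma fano_lines_meet:
  assumes "l \<in> fano_lines" "l' \<in> fano_lines"
  shows "l \<inter> l' \<noteq> {}"
proof (cases "l = l'")
  case True
  then show ?thesis
    using card_fano_line[OF assms(1)] by auto
next
  case False
  then show ?thesis
    using card_Int_fano_lines[OF assms] by auto
qed

text \<open>
  No line other than \<open>l\<close> can contain the two points that are left after removing \<open>i\<close>. This
  is what forbids the exchange of a basis vector below.
\<close>

lemma fano_line_replace_point:
  assumes "l \<in> fano_lines" "i \<in> l" "m \<notin> l"
  shows "insert m (l - {i}) \<notin> fano_lines"
proof
  assume "insert m (l - {i}) \<in> fano_lines"
  then have "card (l \<inter> insert m (l - {i})) = 1"
    using card_Int_fano_lines assms by blast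
  moreover have "l \<inter> insert m (l - {i}) = l - {i}"
    using assms by auto
  ultimately show False
    using card_fano_line[OF assms(1)] assms(2) by simp
qed

text \<open>
  Equivalently, a set of three points that meets every line is itself a line. There are only
  35 sets to inspect.
\<close>

lemma complement_of_line_free_set:
  assumes "J \<subseteq> {0..6}" "card J = 4" "\<And>l. l \<in> fano_lines \<Longrightarrow> \<not> l \<subseteq> J"
  shows "{0..6} - J \<in> fano_lines"
proof -
  have "\<forall>J\<in>Pow (set [0..<7]). card J = 4 \<longrightarrow> (\<forall>l\<in>fano_lines. \<not> l \<subseteq> J) \<longrightarrow>
          set [0..<7] - J \<in> fano_lines"
    unfolding fano_lines_def by code_simp
  moreover have "set [0..<7] = {0..6::nat}"
    by auto
  ultimately show ?thesis
    using assms by auto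
qed

section \<open>Complements spanned by basis vectors\<close>

lemma complement_from_spanning_set:
  fixes W :: "('a::field ^ 'n) set"
  assumes "vec.subspace W" "vec.span B = UNIV"
  obtains J where "J \<subseteq> B" "W \<inter> vec.span J = {0}" "vec.dim W + card J = CARD('n)"
proof -
  obtain A where A: "A \<subseteq> W" "vec.independent A" "W \<subseteq> vec.span A" "card A = vec.dim W"
    using vec.basis_exists by metis
  have W: "vec.span A = W"
    using A assms(1) vec.span_minimal by blast
  obtain C where C: "A \<subseteq> C" "C \<subseteq> A \<union> B" "vec.independent C" "A \<union> B \<subseteq> vec.span C"
    by (rule vec.maximal_independent_subset_extend[of A "A \<union> B"]) (use A in auto)
  have "vec.span C = UNIV"
    using C(4) assms(2) vec.span_minimal[of B "vec.span C"] by auto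
  then have dimC: "card C = CARD('n)"
    using vec.dim_eq_card[of C UNIV] C(3) by (simp add: card_cart_basis)
  have fin: "finite C"
    using C(3) vec.finiteI_independent by blast
  have ind: "vec.independent (C - A)"
    using C(3) vec.independent_mono by blast
  have sum: "{x + y |x y. x \<in> W \<and> y \<in> vec.span (C - A)} = UNIV"
    using vec.span_Un[of A "C - A"] \<open>vec.span C = UNIV\<close> C(1) W by (simp add: Un_absorb1)
  have card: "vec.dim W + card (C - A) = CARD('n)"
    using A(4) C(1) dimC fin by (metis card_Diff_subset card_mono finite_subset le_add_diff_inverse)
  have "vec.dim (vec.span (C - A)) = card (C - A)"
    using ind by (simp add: vec.dim_eq_card_independent)
  then have "vec.dim (W \<inter> vec.span (C - A)) = 0"
    using vec.dim_sums_Int[OF assms(1) vec.subspace_span, of "C - A"] sum card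
    by (simp add: card_cart_basis)
  then have "W \<inter> vec.span (C - A) \<subseteq> {0}"
    by simp
  moreover have "0 \<in> W \<inter> vec.span (C - A)"
    using assms(1) vec.subspace_0 vec.span_zero by blast
  ultimately show ?thesis
    using that[of "C - A"] C(2) card by blast
qed

text \<open>
  Write \<open>x = w + d\<close> along the decomposition into \<open>W\<close> and the span of \<open>J\<close>. As \<open>x \<notin> W\<close>, some
  \<open>y \<in> J\<close> has non-zero coefficient in \<open>d\<close>. This \<open>y\<close> can be replaced: a vector of \<open>W\<close> in the
  new span has the form \<open>k x + s\<close>, and subtracting \<open>k w\<close> puts \<open>k d + s\<close> into
  \<open>W\<close> and into the span of \<open>J\<close>, so it is zero; comparing coefficients of \<open>y\<close> gives \<open>k = 0\<close>.
  What remains is \<open>s\<close>, which lies in \<open>W\<close> and in the span of \<open>J\<close> and so vanishes too.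
\<close>

lemma exchange_in_complement:
  fixes W :: "('a::field ^ 'n) set"
  assumes W: "vec.subspace W" and J: "vec.independent J" "W \<inter> vec.span J = {0}"
    and card: "vec.dim W + card J = CARD('n)" and x: "x \<notin> W"
  obtains y where "y \<in> J" "W \<inter> vec.span (insert x (J - {y})) = {0}"
proof -
  let ?U = "vec.span J"
  have fin: "finite J"
    using J(1) vec.finiteI_independent by blast
  have "vec.dim {u + d |u d. u \<in> W \<and> d \<in> ?U} = CARD('n)"
    using vec.dim_sums_Int[OF W vec.subspace_span, of J] J card
    by (simp add: vec.dim_eq_card_independent)
  moreover have "vec.subspace {u + d |u d. u \<in> W \<and> d \<in> ?U}"
    using vec.subspace_sums[OF W vec.subspace_span] .
  ultimately have "{u + d |u d. u \<in> W \<and> d \<in> ?U} = UNIV"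
    by (intro vec.subspace_dim_equal) (auto simp: card_cart_basis)
  then obtain w d where w: "w \<in> W" and d: "d \<in> ?U" and xwd: "x = w + d"
    by blast
  have d0: "d \<noteq> 0"
    using x w xwd by auto
  obtain c where c: "d = (\<Sum>y\<in>J. c y *s y)"
    using d fin by (auto simp: vec.span_finite)
  then obtain y where y: "y \<in> J" "c y \<noteq> 0"
    using d0 by (metis (no_types, lifting) sum.neutral vec.scale_eq_0_iff)
  have d_notin: "d \<notin> vec.span (J - {y})"
  proof
    assume "d \<in> vec.span (J - {y})"
    moreover have "(\<Sum>z\<in>J - {y}. c z *s z) \<in> vec.span (J - {y})"
      by (intro vec.span_sum vec.span_scale vec.span_base)
    moreover have "c y *s y = d - (\<Sum>z\<in>J - {y}. c z *s z)"
      using c y(1) fin by (simp add: sum.remove)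
    ultimately have "c y *s y \<in> vec.span (J - {y})"
      by (simp add: vec.span_diff)
    then have "y \<in> vec.span (J - {y})"
      using y(2) vec.span_scale[of "c y *s y" "J - {y}" "inverse (c y)"] by simp
    then show False
      using J(1) y(1) vec.dependent_def by blast
  qed
  have "u = 0" if u: "u \<in> W" "u \<in> vec.span (insert x (J - {y}))" for u
  proof -
    obtain k where s: "u - k *s x \<in> vec.span (J - {y})"
      using u(2) vec.span_breakdown_eq by blast
    have sub: "vec.span (J - {y}) \<subseteq> ?U"
      by (intro vec.span_mono) auto
    have eq: "u - k *s w = k *s d + (u - k *s x)"
      by (simp add: xwd vec.scale_right_distrib)
    have "u - k *s w \<in> W"
      using u(1) w W by (simp add: vec.subspace_diff vec.subspace_scale)
    moreover have "u - k *s w \<in> ?U"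
      unfolding eq using d s sub by (intro vec.span_add vec.span_scale) auto
    ultimately have "u - k *s w = 0"
      using J(2) by blast
    then have "k *s d = - (u - k *s x)"
      using eq by (metis add.commute add.inverse_unique)
    then have kd: "k *s d \<in> vec.span (J - {y})"
      using s vec.span_neg by metis
    have "k = 0"
    proof (rule ccontr)
      assume "k \<noteq> 0"
      then have "d \<in> vec.span (J - {y})"
        using vec.span_scale[OF kd, of "inverse k"] by simp
      then show False
        using d_notin by blast
    qed
    then show "u = 0"
      using s sub u(1) J(2) by auto
  qed
  moreover have "0 \<in> W"
    using W vec.subspace_0 by blast
  ultimately have "W \<inter> vec.span (insert x (J - {y})) = {0}"
    using vec.span_zero by blast
  with y(1) show ?thesis
    by (rule that)
qed

section \<open>Incidence with the seven planes\<close>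

lemma proj_Int_nonempty_iff:
  assumes "vec.subspace W" "vec.subspace W'"
  shows "proj W \<inter> proj W' \<noteq> {} \<longleftrightarrow> (\<exists>x\<in>W \<inter> W'. x \<noteq> 0)"
proof
  assume "proj W \<inter> proj W' \<noteq> {}"
  then obtain L where L: "vec.dim L = 1" "L \<subseteq> W \<inter> W'"
    by (auto simp: proj_def)
  then have "\<not> L \<subseteq> {0}"
    by (metis vec.dim_eq_0 zero_neq_one)
  with L(2) show "\<exists>x\<in>W \<inter> W'. x \<noteq> 0"
    by blast
next
  assume "\<exists>x\<in>W \<inter> W'. x \<noteq> 0"
  then obtain x where x: "x \<in> W" "x \<in> W'" "x \<noteq> 0"
    by blast
  have "vec.span {x} \<in> proj W \<inter> proj W'"
    using x assms by (simp add: proj_def vec.span_minimal)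
  then show "proj W \<inter> proj W' \<noteq> {}"
    by blast
qed

lemma dim_span_fano_line:
  fixes v :: "nat \<Rightarrow> 'a::field ^ 'n"
  assumes "inj_on v {0..6}" "vec.independent (v ` {0..6})" "l \<in> fano_lines"
  shows "vec.dim (vec.span (v ` l)) = 3"
proof -
  have "vec.independent (v ` l)" "inj_on v l"
    using assms fano_line_subset[OF assms(3)] vec.independent_mono[OF assms(2) image_mono]
      inj_on_subset by blast+
  then show ?thesis
    using card_fano_line[OF assms(3)] by (simp add: vec.dim_eq_card_independent card_image)
qed

text \<open>
  This is the completeness statement in terms of subspaces. The fact \<open>line\<close> in the proof is used
  twice, for a set \<open>J\<close> obtained by Steinitz exchange and for the modification of \<open>J\<close> that would
  be possible if a basis vector on the complementary line were outside \<open>W\<close>.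
\<close>

lemma subspace_meeting_fano_spans:
  fixes v :: "nat \<Rightarrow> 'a::field ^ 7"
  assumes v: "inj_on v {0..6}" "vec.independent (v ` {0..6})" "vec.span (v ` {0..6}) = UNIV"
    and W: "vec.subspace W" "vec.dim W = 3"
    and meets: "\<And>l. l \<in> fano_lines \<Longrightarrow> \<exists>x\<in>W \<inter> vec.span (v ` l). x \<noteq> 0"
  shows "\<exists>l\<in>fano_lines. W = vec.span (v ` l)"
proof -
  have line: "{0..6} - K \<in> fano_lines"
    if K: "K \<subseteq> {0..6}" "card K = 4" "W \<inter> vec.span (v ` K) = {0}" for K
  proof (rule complement_of_line_free_set[OF K(1,2)])
    fix l assume "l \<in> fano_lines"
    then obtain x where "x \<in> W \<inter> vec.span (v ` l)" "x \<noteq> 0"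
      using meets by blast
    then show "\<not> l \<subseteq> K"
      using K(3) vec.span_mono[OF image_mono, of l K v] by blast
  qed
  obtain J' where J': "J' \<subseteq> v ` {0..6}" "W \<inter> vec.span J' = {0}" "vec.dim W + card J' = CARD(7)"
    using complement_from_spanning_set[OF W(1) v(3)] .
  then obtain J where J: "J \<subseteq> {0..6}" "J' = v ` J"
    by (meson subset_imageE)
  have injJ: "inj_on v J"
    using v(1) J(1) inj_on_subset by blast
  have cardJ: "card J = 4"
    using J'(3) W(2) J(2) card_image[OF injJ] by simp
  define l where "l = {0..6} - J"
  have l: "l \<in> fano_lines"
    unfolding l_def using line J(1) cardJ J'(2) J(2) by blast
  have vW: "v i \<in> W" if i: "i \<in> l" for i
  proof (rule ccontr)
    assume "v i \<notin> W"
    moreover have "vec.independent J'"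
      using v(2) J'(1) vec.independent_mono by blast
    ultimately obtain y where y: "y \<in> J'" "W \<inter> vec.span (insert (v i) (J' - {y})) = {0}"
      using exchange_in_complement[OF W(1) _ J'(2,3)] by blast
    then obtain m where m: "m \<in> J" "y = v m"
      using J(2) by blast
    let ?K = "insert i (J - {m})"
    have "insert (v i) (J' - {y}) = v ` ?K"
      using J(2) m injJ by (auto simp: inj_on_def)
    then have "{0..6} - ?K \<in> fano_lines"
      using y(2) J(1) i m(1) cardJ finite_subset[OF J(1)]
      by (intro line) (auto simp: l_def card_insert_if)
    moreover have "{0..6} - ?K = insert m (l - {i})"
      using J(1) i m(1) by (auto simp: l_def)
    ultimately show False
      using fano_line_replace_point[OF l i] m(1) by (simp add: l_def)
  qed
  have "vec.span (v ` l) \<subseteq> W"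
    using vW W(1) by (intro vec.span_minimal) auto
  moreover have "vec.dim (vec.span (v ` l)) = 3"
    using dim_span_fano_line[OF v(1,2) l] .
  ultimately have "vec.span (v ` l) = W"
    using vec.subspace_dim_equal[OF vec.subspace_span W(1)] W(2) by simp
  with l show ?thesis
    by blast
qed

theorem claim2p1:
  fixes v :: "nat \<Rightarrow> complex ^ 7"
  assumes "inj_on v {0..6}"
    and "vec.independent (v ` {0..6})"
    and "vec.span (v ` {0..6}) = UNIV"
  shows "complete_pairwise_incident_planes
    {proj (vec.span {v 0, v 1, v 2}),
     proj (vec.span {v 2, v 3, v 4}),
     proj (vec.span {v 0, v 4, v 5}),
     proj (vec.span {v 1, v 3, v 5}),
     proj (vec.span {v 0, v 3, v 6}),
     proj (vec.span {v 1, v 4, v 6}),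
     proj (vec.span {v 2, v 5, v 6})}"
proof -
  let ?T = "(\<lambda>l. proj (vec.span (v ` l))) ` fano_lines"
  have "pairwise_incident_planes ?T"
    unfolding pairwise_incident_planes_def
  proof (intro conjI ballI)
    show "?T \<subseteq> planes"
      using dim_span_fano_line[OF assms(1,2)] by (auto simp: planes_def)
  next
    fix P Q assume "P \<in> ?T" "Q \<in> ?T"
    then obtain l l' where l: "l \<in> fano_lines" "P = proj (vec.span (v ` l))"
      and l': "l' \<in> fano_lines" "Q = proj (vec.span (v ` l'))"
      by blast
    obtain i where i: "i \<in> l" "i \<in> l'"
      using fano_lines_meet[OF l(1) l'(1)] by blast
    then have "v i \<noteq> 0"
      using assms(2) fano_line_subset[OF l(1)] vec.dependent_zero by (metis imageI subsetD)
    with i show "P \<inter> Q \<noteq> {}"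
      unfolding l(2) l'(2) by (subst proj_Int_nonempty_iff) (auto intro: vec.span_base)
  qed
  moreover have "P \<in> ?T" if P: "P \<in> planes" "\<forall>Q\<in>?T. P \<inter> Q \<noteq> {}" for P
  proof -
    obtain W where W: "P = proj W" "vec.subspace W" "vec.dim W = 3"
      using P(1) by (auto simp: planes_def)
    have "\<exists>x\<in>W \<inter> vec.span (v ` l). x \<noteq> 0" if "l \<in> fano_lines" for l
      using P(2) that W(1) proj_Int_nonempty_iff[OF W(2) vec.subspace_span] by blast
    then show ?thesis
      using subspace_meeting_fano_spans[OF assms W(2,3)] W(1) by blast
  qed
  ultimately have "complete_pairwise_incident_planes ?T"
    unfolding complete_pairwise_incident_planes_def by blast
  then show ?thesis
    by (simp add: fano_lines_def)
qed

end
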